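(* Let $G=(V(G),E(G))$ be a finite weighted connected discrete graph. Then $[V(G),d_G,m^G,\nu_G]$ satisfies a $2$-Poincaré inequality, that is, $$\lambda^2_{[V(G),d_G,m^G,\nu_G]}=\inf\left\{\frac{TV_{m^G}(u)}{\|u\|_{L^2(V(G),\nu_G)}}:\ \|u\|_{L^2(V(G),\nu_G)}\ne0,\ \int_{V(G)}u(x)\,d\nu_G(x)=0\right\}>0.$$
   Context: $G$ has finite vertex set $V(G)$; each edge $(x,y)\in E(G)$ (written $x\sim y$; loops allowed) carries a weight $w_{xy}=w_{yx}>0$, and $w_{xy}=0$ if $(x,y)\notin E(G)$. Connected means any two vertices are joined by a path of edges; $d_G$ is the graph distance (minimal number of edges in a connecting path). For $x\in V(G)$, $d_x:=\sum_{y\in V(G)}w_{xy}$ (positive), $m^G_x:=\frac1{d_x}\sum_{y\sim x}w_{xy}\delta_y$, and $\nu_G(A):=\sum_{x\in A}d_x$ for $A\subset V(G)$. For $u:V(G)\to\mathbb R$, $$TV_{m^G}(u)=\frac12\int_{V(G)}\int_{V(G)}|u(y)-u(x)|\,dm^G_x(y)\,d\nu_G(x)=\frac12\sum_{x\in V(G)}\sum_{y\in V(G)}|u(y)-u(x)|\,w_{xy}.$$ A $2$-Poincaré inequality means: there is $c>0$ such that $\|u\|_{L^2(V(G),\nu_G)}\le c\left(2\,TV_{m^G}(u)+\left|\int_{V(G)}u\,d\nu_G\right|\right)$ for all $u:V(G)\to\mathbb R$. The infimum is over functions $u:V(G)\to\mathbb R$. *)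

theory Defs
  imports "HOL-Analysis.Analysis" "Graph_Theory.Graph_Theory"
begin

section \<open>Random walk spaces\<close>

text \<open>
  The data \<open>[X, d, m, \<nu>]\<close>: a set, a distance on it, a measure \<open>m x\<close> for each point \<open>x\<close>, and a
  reference measure.
\<close>

record 'a random_walk_space =
  points :: "'a set"
  distance :: "'a \<Rightarrow> 'a \<Rightarrow> real"
  walk :: "'a \<Rightarrow> 'a measure"
  ref_measure :: "'a measure"

text \<open>
  The definitions below use Bochner integrals, and functions on \<open>X\<close> are represented by functions on
  the whole type. They are meant for finite \<open>X\<close> carrying the discrete sigma-algebra and finite
  measures: then every function is integrable and its values outside \<open>X\<close> are irrelevant, so no
  integrability condition is imposed on \<open>u\<close>.
\<close>

definition total_variation :: "('a, 'b) random_walk_space_scheme \<Rightarrow> ('a \<Rightarrow> real) \<Rightarrow> real" where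
  "total_variation W u =
     1 / 2 * (\<integral>x. (\<integral>y. \<bar>u y - u x\<bar> \<partial>walk W x) \<partial>ref_measure W)"

definition norm_L2 :: "('a, 'b) random_walk_space_scheme \<Rightarrow> ('a \<Rightarrow> real) \<Rightarrow> real" where
  "norm_L2 W u = sqrt (\<integral>x. \<bar>u x\<bar>\<^sup>2 \<partial>ref_measure W)"

definition satisfies_2_Poincare :: "('a, 'b) random_walk_space_scheme \<Rightarrow> bool" where
  "satisfies_2_Poincare W \<longleftrightarrow>
     (\<exists>c>0. \<forall>u. norm_L2 W u \<le> c * (2 * total_variation W u + \<bar>\<integral>x. u x \<partial>ref_measure W\<bar>))"

text \<open>
  The infimum is taken in the extended reals: for a one-point space there is no admissible
  \<open>u\<close>, and the infimum of the empty set is \<open>\<infinity>\<close>.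
\<close>

definition lambda_2 :: "('a, 'b) random_walk_space_scheme \<Rightarrow> ereal" where
  "lambda_2 W =
     (INF u \<in> {u. norm_L2 W u \<noteq> 0 \<and> (\<integral>x. u x \<partial>ref_measure W) = 0}.
        ereal (total_variation W u / norm_L2 W u))"


section \<open>Finite weighted graphs\<close>

text \<open>
  An undirected edge is a symmetric pair of arcs; loops are allowed, parallel edges are not.
\<close>

locale finite_weighted_graph = pair_pseudo_graph G
  for G :: "'a pair_pre_digraph" +
  fixes w :: "'a \<Rightarrow> 'a \<Rightarrow> real"
  assumes weight_sym: "\<And>x y. x \<in> pverts G \<Longrightarrow> y \<in> pverts G \<Longrightarrow> w x y = w y x"
    and weight_pos: "\<And>x y. (x, y) \<in> parcs G \<Longrightarrow> 0 < w x y"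
    and weight_zero:
      "\<And>x y. x \<in> pverts G \<Longrightarrow> y \<in> pverts G \<Longrightarrow> (x, y) \<notin> parcs G \<Longrightarrow> w x y = 0"
    and weighted_degree_pos: "\<And>x. x \<in> pverts G \<Longrightarrow> 0 < (\<Sum>y\<in>pverts G. w x y)"

definition graph_dist :: "'a pair_pre_digraph \<Rightarrow> 'a \<Rightarrow> 'a \<Rightarrow> nat" where
  "graph_dist G x y = Inf {length p |p. pre_digraph.awalk (with_proj G) x p y}"

definition weighted_degree :: "'a pair_pre_digraph \<Rightarrow> ('a \<Rightarrow> 'a \<Rightarrow> real) \<Rightarrow> 'a \<Rightarrow> real" where
  "weighted_degree G w x = (\<Sum>y\<in>pverts G. w x y)"

definition graph_walk :: "'a pair_pre_digraph \<Rightarrow> ('a \<Rightarrow> 'a \<Rightarrow> real) \<Rightarrow> 'a \<Rightarrow> 'a measure" where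
  "graph_walk G w x =
     point_measure (pverts G)
       (\<lambda>y. if (x, y) \<in> parcs G then ennreal (w x y / weighted_degree G w x) else 0)"

definition graph_measure :: "'a pair_pre_digraph \<Rightarrow> ('a \<Rightarrow> 'a \<Rightarrow> real) \<Rightarrow> 'a measure" where
  "graph_measure G w = point_measure (pverts G) (\<lambda>x. ennreal (weighted_degree G w x))"

definition graph_space ::
  "'a pair_pre_digraph \<Rightarrow> ('a \<Rightarrow> 'a \<Rightarrow> real) \<Rightarrow> 'a random_walk_space" where
  "graph_space G w =
     \<lparr> points = pverts G,
       distance = (\<lambda>x y. real (graph_dist G x y)),
       walk = graph_walk G w,
       ref_measure = graph_measure G w \<rparr>"

context finite_weighted_graph
begin

lemma weighted_degree_gt_0: "x \<in> pverts G \<Longrightarrow> 0 < weighted_degree G w x"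
  unfolding weighted_degree_def by (rule weighted_degree_pos)

lemma weight_nonneg: "x \<in> pverts G \<Longrightarrow> y \<in> pverts G \<Longrightarrow> 0 \<le> w x y"
  using weight_pos[of x y] weight_zero[of x y] by (cases "(x, y) \<in> parcs G") auto

lemma graph_walk_eq:
  assumes "x \<in> pverts G"
  shows "graph_walk G w x =
    point_measure (pverts G) (\<lambda>y. ennreal (w x y / weighted_degree G w x))"
  unfolding graph_walk_def point_measure_def
  using assms weight_zero by (intro density_cong) (auto simp: AE_count_space)

lemma integral_graph_measure:
  fixes f :: "'a \<Rightarrow> real"
  shows "(\<integral>x. f x \<partial>graph_measure G w) = (\<Sum>x\<in>pverts G. weighted_degree G w x * f x)"
  unfolding graph_measure_def
  using pair_finite_verts weighted_degree_gt_0
  by (subst lebesgue_integral_point_measure_finite) (auto intro: less_imp_le)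

lemma integral_graph_walk:
  fixes f :: "'a \<Rightarrow> real"
  assumes "x \<in> pverts G"
  shows "(\<integral>y. f y \<partial>graph_walk G w x) = (\<Sum>y\<in>pverts G. w x y / weighted_degree G w x * f y)"
  unfolding graph_walk_eq[OF assms]
  using pair_finite_verts weighted_degree_gt_0[OF assms] weight_nonneg[OF assms]
  by (subst lebesgue_integral_point_measure_finite) auto

lemma measure_graph_measure:
  "A \<subseteq> pverts G \<Longrightarrow> measure (graph_measure G w) A = (\<Sum>x\<in>A. weighted_degree G w x)"
  unfolding graph_measure_def
  using pair_finite_verts weighted_degree_gt_0
  by (subst measure_point_measure_finite_if) (auto intro: less_imp_le)

lemma total_variation_graph_space:
  "total_variation (graph_space G w) u =
     1 / 2 * (\<Sum>x\<in>pverts G. \<Sum>y\<in>pverts G. \<bar>u y - u x\<bar> * w x y)"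
proof -
  have "weighted_degree G w x * (\<integral>y. \<bar>u y - u x\<bar> \<partial>graph_walk G w x) =
      (\<Sum>y\<in>pverts G. \<bar>u y - u x\<bar> * w x y)" if x: "x \<in> pverts G" for x
    unfolding integral_graph_walk[OF x] sum_distrib_left
    using weighted_degree_gt_0[OF x] by (intro sum.cong) auto
  then show ?thesis
    by (simp add: total_variation_def graph_space_def integral_graph_measure)
qed

end

end

theory Submission
  imports Defs
begin

text \<open>
  A single arc \<open>(x, y)\<close> contributes \<open>\<bar>u y - u x\<bar> * w x y\<close> to \<open>2 TV(u)\<close>, so the jump of \<open>u\<close> across it is
  at most \<open>2 TV(u) / w x y\<close>. Adding these jumps along a path bounds the difference of \<open>u\<close> between any
  two vertices of a connected graph by a multiple of \<open>TV(u)\<close>, and since there are finitely many pairs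
  of vertices, one constant \<open>C\<close>, independent of \<open>u\<close>, serves them all (\<open>difference_le_uniform\<close>).

  The mean of \<open>u\<close> is an average of its values, hence each value lies within \<open>2 C TV(u)\<close> of the
  mean. This bounds \<open>\<bar>u\<bar>\<close> pointwise by \<open>2 C TV(u)\<close> plus the absolute value of the mean, and the \<open>L2\<close>
  norm is at most the square root of the total mass times this bound. That is the Poincare
  inequality. For functions of mean zero it reads \<open>norm_L2 W u \<le> 2 c TV(u)\<close>, so all quotients
  in the infimum are at least \<open>1 / (2 c)\<close>.
\<close>

lemma lambda_2_pos_if_Poincare:
  assumes "satisfies_2_Poincare W"
  shows "lambda_2 W > 0"
proof -
  obtain c where c: "c > 0" and poincare:
    "\<And>u. norm_L2 W u \<le> c * (2 * total_variation W u + \<bar>\<integral>x. u x \<partial>ref_measure W\<bar>)"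
    using assms unfolding satisfies_2_Poincare_def by blast
  have "ereal (1 / (2 * c)) \<le> lambda_2 W"
    unfolding lambda_2_def
  proof (rule INF_greatest)
    fix u assume "u \<in> {u. norm_L2 W u \<noteq> 0 \<and> (\<integral>x. u x \<partial>ref_measure W) = 0}"
    then have nz: "norm_L2 W u \<noteq> 0" and mean: "(\<integral>x. u x \<partial>ref_measure W) = 0"
      by auto
    have "norm_L2 W u \<ge> 0"
      by (simp add: norm_L2_def)
    with nz have "norm_L2 W u > 0" by simp
    moreover have "norm_L2 W u \<le> total_variation W u * (2 * c)"
      using poincare[of u] mean by (simp add: mult_ac)
    ultimately show "ereal (1 / (2 * c)) \<le> ereal (total_variation W u / norm_L2 W u)"
      using c by (simp add: field_simps)
  qed
  moreover have "0 < ereal (1 / (2 * c))"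
    using c by simp
  ultimately show ?thesis
    by (rule less_le_trans[rotated])
qed

context finite_weighted_graph
begin

lemma arc_difference_le:
  assumes arc: "(x, y) \<in> parcs G"
  shows "\<bar>u y - u x\<bar> \<le> 1 / w x y * (2 * total_variation (graph_space G w) u)"
proof -
  have x: "x \<in> pverts G" and y: "y \<in> pverts G"
    using arc by (auto dest: in_arcsD1 in_arcsD2)
  let ?jump = "\<lambda>x y. \<bar>u y - u x\<bar> * w x y"
  have "?jump x y \<le> (\<Sum>y\<in>pverts G. ?jump x y)"
    using x y pair_finite_verts weight_nonneg by (intro member_le_sum) auto
  also have "\<dots> \<le> (\<Sum>x\<in>pverts G. \<Sum>y\<in>pverts G. ?jump x y)"
    using x pair_finite_verts weight_nonneg
    by (intro member_le_sum[where f = "\<lambda>x. \<Sum>y\<in>pverts G. ?jump x y"] sum_nonneg) auto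
  finally show ?thesis
    using weight_pos[OF arc] by (simp add: total_variation_graph_space field_simps)
qed

lemma total_variation_nonneg: "0 \<le> total_variation (graph_space G w) u"
  unfolding total_variation_graph_space by (auto intro!: sum_nonneg mult_nonneg_nonneg weight_nonneg)

text \<open>Along a path from \<open>x\<close> to \<open>y\<close> the triangle inequality makes the constants of its arcs add up.\<close>

lemma difference_le_if_reachable:
  assumes "x \<rightarrow>\<^sup>*\<^bsub>with_proj G\<^esub> y"
  shows "\<exists>C\<ge>0. \<forall>u. \<bar>u y - u x\<bar> \<le> C * (2 * total_variation (graph_space G w) u)"
  using assms
proof (induction rule: reachable_induct)
  case base
  show ?case by (intro exI[of _ 0]) auto
next
  case (step y z)
  then obtain C where C: "C \<ge> 0"
    "\<And>u. \<bar>u y - u x\<bar> \<le> C * (2 * total_variation (graph_space G w) u)"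
    by blast
  have arc: "(y, z) \<in> parcs G"
    using step.hyps by simp
  have "\<bar>u z - u x\<bar> \<le> (C + 1 / w y z) * (2 * total_variation (graph_space G w) u)" for u
    using C(2)[of u] arc_difference_le[OF arc, of u] by (simp only: distrib_right)
  moreover have "C + 1 / w y z \<ge> 0"
    using C(1) weight_pos[OF arc] by simp
  ultimately show ?case by blast
qed

lemma difference_le_uniform:
  assumes "Digraph_Component.connected (with_proj G)"
  shows "\<exists>C\<ge>0. \<forall>u. \<forall>x\<in>pverts G. \<forall>y\<in>pverts G.
    \<bar>u y - u x\<bar> \<le> C * (2 * total_variation (graph_space G w) u)"
proof -
  have "strongly_connected (with_proj G)"
    using pair_sym_arcs assms by (rule symmetric_connected_imp_strongly_connected)
  then have "\<forall>p\<in>pverts G \<times> pverts G. \<exists>C\<ge>0. \<forall>u.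
      \<bar>u (snd p) - u (fst p)\<bar> \<le> C * (2 * total_variation (graph_space G w) u)"
    by (auto simp: strongly_connected_def intro!: difference_le_if_reachable)
  then obtain C where C: "\<And>p. p \<in> pverts G \<times> pverts G \<Longrightarrow> C p \<ge> 0 \<and> (\<forall>u.
      \<bar>u (snd p) - u (fst p)\<bar> \<le> C p * (2 * total_variation (graph_space G w) u))"
    by metis
  \<comment> \<open>The sum of the nonnegative constants of all pairs dominates each of them.\<close>
  let ?C = "\<Sum>p\<in>pverts G \<times> pverts G. C p"
  have "\<bar>u y - u x\<bar> \<le> ?C * (2 * total_variation (graph_space G w) u)"
    if "x \<in> pverts G" "y \<in> pverts G" for u x y
  proof -
    have xy: "(x, y) \<in> pverts G \<times> pverts G"
      using that by simp
    have "C (x, y) \<le> ?C"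
      using xy C pair_finite_verts by (intro member_le_sum) auto
    then have "C (x, y) * (2 * total_variation (graph_space G w) u)
        \<le> ?C * (2 * total_variation (graph_space G w) u)"
      using total_variation_nonneg by (intro mult_right_mono) auto
    then show ?thesis
      using C[OF xy] by (auto intro: order_trans)
  qed
  moreover have "?C \<ge> 0"
    using C by (intro sum_nonneg) auto
  ultimately show ?thesis by blast
qed

lemma norm_L2_le:
  assumes "\<And>x. x \<in> pverts G \<Longrightarrow> \<bar>u x\<bar> \<le> B" and "B \<ge> 0"
  shows "norm_L2 (graph_space G w) u \<le> sqrt (\<Sum>x\<in>pverts G. weighted_degree G w x) * B"
proof -
  have "(\<Sum>x\<in>pverts G. weighted_degree G w x * \<bar>u x\<bar>\<^sup>2)
      \<le> (\<Sum>x\<in>pverts G. weighted_degree G w x * B\<^sup>2)"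
    using assms weighted_degree_gt_0
    by (intro sum_mono mult_left_mono power_mono) (auto intro: less_imp_le)
  also have "\<dots> = (\<Sum>x\<in>pverts G. weighted_degree G w x) * B\<^sup>2"
    by (simp add: sum_distrib_right)
  finally have "norm_L2 (graph_space G w) u
      \<le> sqrt ((\<Sum>x\<in>pverts G. weighted_degree G w x) * B\<^sup>2)"
    by (simp add: norm_L2_def graph_space_def integral_graph_measure)
  then show ?thesis
    using \<open>B \<ge> 0\<close> by (simp add: real_sqrt_mult)
qed

text \<open>
  Multiplying \<open>u x\<close> by the total mass turns it into the integral of \<open>u\<close> plus the weighted sum of the
  differences \<open>u x - u y\<close>, which a bound \<open>D\<close> on these differences controls.
\<close>

lemma abs_le_difference_plus_mean:
  assumes x: "x \<in> pverts G"
    and D: "\<And>y. y \<in> pverts G \<Longrightarrow> \<bar>u x - u y\<bar> \<le> D"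
  shows "\<bar>u x\<bar> \<le> D + \<bar>\<integral>y. u y \<partial>graph_measure G w\<bar> / (\<Sum>y\<in>pverts G. weighted_degree G w y)"
proof -
  let ?d = "weighted_degree G w"
  let ?M = "\<Sum>y\<in>pverts G. ?d y" and ?I = "\<integral>y. u y \<partial>graph_measure G w"
  have M: "?M > 0"
    using x pair_finite_verts weighted_degree_gt_0 by (intro sum_pos) auto
  have "?M * u x = (\<Sum>y\<in>pverts G. ?d y * (u x - u y)) + ?I"
    by (simp add: integral_graph_measure sum_distrib_right right_diff_distrib sum_subtractf)
  moreover have "\<bar>\<Sum>y\<in>pverts G. ?d y * (u x - u y)\<bar> \<le> (\<Sum>y\<in>pverts G. ?d y * D)"
    using D weighted_degree_gt_0
    by (intro order_trans[OF sum_abs] sum_mono)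
      (auto simp: abs_mult less_imp_le intro!: mult_mono)
  ultimately have "\<bar>?M * u x\<bar> \<le> ?M * D + \<bar>?I\<bar>"
    by (simp add: sum_distrib_right)
  then have "\<bar>u x\<bar> * ?M \<le> ?M * D + \<bar>?I\<bar>"
    using M by (simp add: abs_mult mult.commute)
  then show ?thesis
    using M by (simp add: field_simps)
qed

lemma Poincare_if_connected:
  assumes conn: "Digraph_Component.connected (with_proj G)"
  shows "satisfies_2_Poincare (graph_space G w)"
proof -
  obtain C where C: "C \<ge> 0" and diff: "\<And>u x y. x \<in> pverts G \<Longrightarrow> y \<in> pverts G \<Longrightarrow>
      \<bar>u y - u x\<bar> \<le> C * (2 * total_variation (graph_space G w) u)"
    using difference_le_uniform[OF conn] by blast
  define M where "M = (\<Sum>x\<in>pverts G. weighted_degree G w x)"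
  have "pverts G \<noteq> {}"
    using conn by (auto simp: connected_def strongly_connected_def mk_symmetric_def)
  then have M: "M > 0"
    unfolding M_def using pair_finite_verts weighted_degree_gt_0 by (intro sum_pos) auto
  have "norm_L2 (graph_space G w) u \<le> sqrt M * (C + 1 / M) *
      (2 * total_variation (graph_space G w) u + \<bar>\<integral>x. u x \<partial>graph_measure G w\<bar>)" for u
  proof -
    let ?T = "2 * total_variation (graph_space G w) u"
    let ?I = "\<bar>\<integral>x. u x \<partial>graph_measure G w\<bar>"
    have T: "?T \<ge> 0"
      using total_variation_nonneg by simp
    have "norm_L2 (graph_space G w) u \<le> sqrt M * (C * ?T + ?I / M)"
      unfolding M_def
    proof (rule norm_L2_le)
      show "\<bar>u x\<bar> \<le> C * ?T + ?I / (\<Sum>x\<in>pverts G. weighted_degree G w x)"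
        if "x \<in> pverts G" for x
        using that diff by (intro abs_le_difference_plus_mean) auto
      show "0 \<le> C * ?T + ?I / (\<Sum>x\<in>pverts G. weighted_degree G w x)"
        using C T M unfolding M_def by (intro add_nonneg_nonneg mult_nonneg_nonneg) auto
    qed
    also have "\<dots> \<le> sqrt M * ((C + 1 / M) * (?T + ?I))"
    proof (rule mult_left_mono)
      have "0 \<le> C * ?I" "0 \<le> ?T / M"
        using C T M by (auto intro!: mult_nonneg_nonneg divide_nonneg_pos simp del: zero_le_divide_iff)
      then show "C * ?T + ?I / M \<le> (C + 1 / M) * (?T + ?I)"
        by (simp add: distrib_left distrib_right)
    qed (use M in simp)
    finally show ?thesis by (simp only: mult.assoc)
  qed
  moreover have "sqrt M * (C + 1 / M) > 0"
    using C M by (simp add: add_nonneg_pos)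
  ultimately show ?thesis
    unfolding satisfies_2_Poincare_def by (auto simp: graph_space_def)
qed

end

theorem theorem4p10:
  fixes G :: "'a pair_pre_digraph" and w :: "'a \<Rightarrow> 'a \<Rightarrow> real"
  assumes "finite_weighted_graph G w"
    and "Digraph_Component.connected (with_proj G)"
  shows "satisfies_2_Poincare (graph_space G w) \<and> lambda_2 (graph_space G w) > 0"
proof -
  interpret finite_weighted_graph G w by (rule assms(1))
  show ?thesis
    using Poincare_if_connected[OF assms(2)] lambda_2_pos_if_Poincare by blast
qed

end
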